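(* Let $G$ be a complete multipartite graph with parts $X_1, \ldots, X_r$. Then there exists an optimal strong geodetic set $S$ of $G$ such that for all but at most two indices $i \in \{1,\ldots,r\}$, the intersection $S \cap X_i$ is either empty or equal to $X_i$.
   Context: A complete multipartite graph with parts $X_1,\dots,X_r$ is the finite simple graph whose vertex set is the disjoint union of the nonempty sets $X_1,\dots,X_r$, in which two vertices are adjacent if and only if they lie in different parts. Let $G=(V,E)$ be a finite simple graph. For a set $S\subseteq V$ and for each pair of distinct vertices $\{x,y\}\subseteq S$, select one fixed shortest path $\widetilde{g}(x,y)$ between $x$ and $y$ in $G$. If the selection can be made so that the selected shortest paths (one per pair) together cover all vertices of $G$, i.e. the union of their vertex sets is $V$, then $S$ is called a strong geodetic set of $G$. If $G$ has just one vertex, that vertex is considered the unique strong geodetic set. The strong geodetic number $\mathrm{sg}(G)$ is the minimum size of a strong geodetic set of $G$; a strong geodetic set of size $\mathrm{sg}(G)$ is called an optimal strong geodetic set.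
   Formalization: The graph G is additionally assumed connected, which excludes only the empty graph and a single part X_1 with at least two vertices; in the latter case G has no edges, no strong geodetic set exists and the claim fails. *)

theory Defs
  imports "Graph_Theory.Graph_Theory"
begin

text \<open>
  Finite simple graphs are rendered by the locale \<open>pair_graph\<close>: a finite vertex set together
  with a symmetric, irreflexive set of arcs, each edge being represented by its two orientations.
\<close>

definition complete_multipartite :: "'a pair_pre_digraph \<Rightarrow> nat \<Rightarrow> (nat \<Rightarrow> 'a set) \<Rightarrow> bool" where
  "complete_multipartite G r X \<longleftrightarrow>
     pair_graph G \<and>
     (\<forall>i\<in>{1..r}. X i \<noteq> {}) \<and>
     disjoint_family_on X {1..r} \<and>
     pverts G = (\<Union>i\<in>{1..r}. X i) \<and>
     (\<forall>u\<in>pverts G. \<forall>v\<in>pverts G.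
        (u, v) \<in> parcs G \<longleftrightarrow> (\<exists>i\<in>{1..r}. \<exists>j\<in>{1..r}. i \<noteq> j \<and> u \<in> X i \<and> v \<in> X j))"

definition path_between :: "'a pair_pre_digraph \<Rightarrow> 'a \<Rightarrow> 'a vwalk \<Rightarrow> 'a \<Rightarrow> bool" where
  "path_between G x p y \<longleftrightarrow> vpath p (with_proj G) \<and> hd p = x \<and> last p = y"

definition shortest_path :: "'a pair_pre_digraph \<Rightarrow> 'a \<Rightarrow> 'a vwalk \<Rightarrow> 'a \<Rightarrow> bool" where
  "shortest_path G x p y \<longleftrightarrow>
     path_between G x p y \<and> (\<forall>q. path_between G x q y \<longrightarrow> vwalk_length p \<le> vwalk_length q)"

text \<open>
  The selection \<open>g\<close> is indexed by the two-element subsets \<open>e\<close> of \<open>S\<close>, so that exactly one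
  shortest path is chosen for each unordered pair; its orientation is irrelevant.
  A pair of vertices in different components admits no selection.
\<close>

definition strong_geodetic_set :: "'a pair_pre_digraph \<Rightarrow> 'a set \<Rightarrow> bool" where
  "strong_geodetic_set G S \<longleftrightarrow>
     S \<subseteq> pverts G \<and>
     (if card (pverts G) = 1 then S = pverts G
      else \<exists>g :: 'a set \<Rightarrow> 'a vwalk.
        (\<forall>e. e \<subseteq> S \<and> card e = 2 \<longrightarrow> (\<exists>x y. e = {x, y} \<and> shortest_path G x (g e) y)) \<and>
        (\<Union>e\<in>{e. e \<subseteq> S \<and> card e = 2}. set (g e)) = pverts G)"

text \<open>
  The minimum is over a nonempty set whenever \<open>G\<close> is connected; for a graph without strong
  geodetic sets the value is unspecified.
\<close>

definition sg :: "'a pair_pre_digraph \<Rightarrow> nat" where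
  "sg G = (LEAST n. \<exists>S. strong_geodetic_set G S \<and> card S = n)"

definition optimal_strong_geodetic_set :: "'a pair_pre_digraph \<Rightarrow> 'a set \<Rightarrow> bool" where
  "optimal_strong_geodetic_set G S \<longleftrightarrow> strong_geodetic_set G S \<and> card S = sg G"

end

theory Submission
  imports Defs
begin

text \<open>
  Two vertices in different parts span a shortest path that is an edge; two vertices in the same
  part have distance 2, and the midpoint of the selected path is any vertex of another part. So
  \<open>S\<close> is a strong geodetic set iff the vertices outside \<open>S\<close> can be assigned to distinct
  monochromatic pairs of \<open>S\<close>, each to a pair in a part other than its own. With
  \<open>s\<^sub>i = card (S \<inter> X i)\<close>, \<open>u\<^sub>i = card (X i - S)\<close> and \<open>M = (\<Sum>i. s\<^sub>i choose 2)\<close> this is equivalent to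
  the Hall-type conditions \<open>(\<Sum>i. u\<^sub>i) \<le> M\<close> and \<open>u\<^sub>i + (s\<^sub>i choose 2) \<le> M\<close> for all \<open>i\<close>.
  Take an optimal \<open>S\<close> that maximizes \<open>M\<close>. If three parts \<open>a\<close>, \<open>b\<close>, \<open>c\<close> are split by \<open>S\<close> and \<open>s\<^sub>c\<close> is
  smallest, move one vertex of \<open>S\<close> from part \<open>c\<close> to part \<open>a\<close> or to part \<open>b\<close>. By convexity \<open>M\<close> grows,
  and the only condition that may break is the one for the part that receives the vertex. It
  cannot break for both \<open>a\<close> and \<open>b\<close>, since adding the two failures contradicts the conditions
  for \<open>S\<close>.
\<close>

section \<open>Injections avoiding a forbidden colour\<close>

text \<open>Among the injections of \<open>D\<close> into \<open>P\<close> take one with the fewest elements mapped to their own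
  colour; if there is one, a swap with another value, used or not, reduces their number.\<close>

lemma ex_inj_on_off_colour:
  fixes c :: "'d \<Rightarrow> 'i" and k :: "'p \<Rightarrow> 'i"
  assumes fin: "finite D" "finite P"
    and le: "card D \<le> card P"
    and col: "\<And>i. i \<in> c ` D \<Longrightarrow> card {d \<in> D. c d = i} + card {p \<in> P. k p = i} \<le> card P"
  shows "\<exists>h. inj_on h D \<and> h ` D \<subseteq> P \<and> (\<forall>d\<in>D. k (h d) \<noteq> c d)"
proof -
  define bad where "bad h = {d \<in> D. k (h d) = c d}" for h :: "'d \<Rightarrow> 'p"
  have "\<exists>h. inj_on h D \<and> h ` D \<subseteq> P"
    using card_le_inj[OF fin le] by blast
  then have "\<exists>h. (inj_on h D \<and> h ` D \<subseteq> P) \<and>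
      (\<forall>h'. inj_on h' D \<and> h' ` D \<subseteq> P \<longrightarrow> card (bad h) \<le> card (bad h'))"
    by (elim exE) (rule ex_has_least_nat)
  then obtain h where h: "inj_on h D" "h ` D \<subseteq> P"
    and least: "\<forall>h'. inj_on h' D \<and> h' ` D \<subseteq> P \<longrightarrow> card (bad h) \<le> card (bad h')"
    by (elim exE conjE)
  have minimal: "\<not> bad h' \<subset> bad h" if "inj_on h' D" "h' ` D \<subseteq> P" for h'
  proof
    assume "bad h' \<subset> bad h"
    moreover have "finite (bad h)"
      using fin by (simp add: bad_def)
    ultimately have "card (bad h') < card (bad h)"
      by (rule psubset_card_mono[rotated])
    with least that show False
      by (simp add: not_less[symmetric])
  qed
  have "bad h = {}"
  proof (rule ccontr)
    assume "bad h \<noteq> {}"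
    then obtain d where d: "d \<in> D" "k (h d) = c d"
      by (auto simp: bad_def)
    have unused: "k p = c d" if p: "p \<in> P" "p \<notin> h ` D" for p
    proof (rule ccontr)
      assume "k p \<noteq> c d"
      then have "bad (h(d := p)) \<subset> bad h"
        using d by (auto simp: bad_def)
      moreover have "inj_on (h(d := p)) D" "(h(d := p)) ` D \<subseteq> P"
        using h p by (auto simp: inj_on_def)
      ultimately show False
        using minimal by blast
    qed
    have used: "c d' = c d" if d': "d' \<in> D" "k (h d') \<noteq> c d" for d'
    proof (rule ccontr)
      assume "c d' \<noteq> c d"
      then have "bad (h(d := h d', d' := h d)) \<subset> bad h"
        using d d' by (auto simp: bad_def)
      moreover have "inj_on (h(d := h d', d' := h d)) D"
        using h(1) d(1) d'(1) unfolding inj_on_def by (auto split: if_splits)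
      moreover have "(h(d := h d', d' := h d)) ` D \<subseteq> P"
        using h d d' by (auto simp: image_subset_iff)
      ultimately show False
        using minimal by blast
    qed
    \<comment> \<open>Every value of another colour is the image of an element coloured
      \<open>c d\<close>, and not of \<open>d\<close>, whose own value has colour
      \<open>c d\<close>. So such values are too few, contrary to \<open>col\<close>.\<close>
    have "{p \<in> P. k p \<noteq> c d} \<subseteq> h ` ({d' \<in> D. c d' = c d} - {d})"
    proof
      fix p assume p: "p \<in> {p \<in> P. k p \<noteq> c d}"
      with unused obtain d' where d': "d' \<in> D" "p = h d'" by blast
      have "k (h d') \<noteq> c d"
        using p d'(2) by simp
      then have "d' \<in> {d' \<in> D. c d' = c d} - {d}"
        using used[OF d'(1)] d'(1) d(2) by auto
      then show "p \<in> h ` ({d' \<in> D. c d' = c d} - {d})"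
        unfolding d'(2) by (rule imageI)
    qed
    then have "card {p \<in> P. k p \<noteq> c d} \<le> card ({d' \<in> D. c d' = c d} - {d})"
      using fin by (intro surj_card_le) auto
    also have "\<dots> < card {d' \<in> D. c d' = c d}"
      using d fin by (intro card_Diff1_less) auto
    finally have "card {p \<in> P. k p \<noteq> c d} < card {d' \<in> D. c d' = c d}" .
    moreover have "card P = card {p \<in> P. k p = c d} + card {p \<in> P. k p \<noteq> c d}"
      using fin by (subst card_Un_disjoint[symmetric]) (auto intro: arg_cong[where f = card])
    ultimately show False
      using col[of "c d"] d by simp
  qed
  then show ?thesis
    using h by (auto simp: bad_def)
qed

section \<open>Elementary facts on binomial coefficients and paths\<close>

lemma choose_two_Suc: "Suc n choose 2 = (n choose 2) + n"
  by (simp add: numeral_2_eq_2)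

text \<open>The right side minus the left is (n - 2)(n - 3)/2, which is nonnegative at every
  integer. In the induction the left side grows by 2 and the right by \<open>n\<close>, so
  \<open>n \<le> 1\<close> is treated apart.\<close>

lemma double_le_choose_two: "2 * n \<le> (n choose 2) + 3"
proof (induction n)
  case (Suc n)
  then show ?case
    by (cases "n \<le> 1") (auto simp: choose_two_Suc le_Suc_eq)
qed simp

lemma path_between_Cons_Cons:
  assumes "path_between G x p y" "x \<noteq> y"
  obtains z q where "p = x # z # q" "last (z # q) = y" "distinct p" "set p \<subseteq> pverts G"
    "(x, z) \<in> parcs G"
proof -
  have "p \<noteq> []" "hd p = x" "last p = y"
    using assms by (auto simp: path_between_def vpath_def vwalk_def)
  then obtain z q where "p = x # z # q"
    using assms(2) by (metis last.simps list.collapse)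
  then show thesis
    using assms \<open>last p = y\<close> by (intro that[of z q]) (auto simp: path_between_def vpath_def vwalk_def)
qed

section \<open>Complete multipartite graphs with at least two parts\<close>

locale multipartite =
  fixes G :: "'a pair_pre_digraph" and r :: nat and X :: "nat \<Rightarrow> 'a set"
  assumes multipartite: "complete_multipartite G r X"
    and two_parts: "2 \<le> r"
begin

abbreviation V :: "'a set" where "V \<equiv> pverts G"

text \<open>Parts act as colours. The value is meaningful only on \<open>V\<close>, where
  disjointness makes the index unique.\<close>

definition part :: "'a \<Rightarrow> nat" where
  "part v = (THE i. i \<in> {1..r} \<and> v \<in> X i)"

text \<open>For \<open>S \<subseteq> V\<close> these are the pairs at distance 2, the only ones
  whose selected path can leave \<open>S\<close>.\<close>

definition mono_pairs :: "'a set \<Rightarrow> 'a set set" where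
  "mono_pairs S = {e. e \<subseteq> S \<and> card e = 2 \<and> (\<exists>i. part ` e = {i})}"

text \<open>A closed form for the size of \<open>mono_pairs S\<close>, from which the effect of
  moving one vertex can be computed.\<close>

definition num_pairs :: "'a set \<Rightarrow> nat" where
  "num_pairs S = (\<Sum>i\<in>{1..r}. card (S \<inter> X i) choose 2)"

lemma finite_V: "finite V"
  using multipartite pair_fin_digraph.pair_finite_verts[of G]
  by (auto simp: complete_multipartite_def pair_graph_def pair_digraph_def)

lemma X_nonempty: "X i \<noteq> {}" if "i \<in> {1..r}"
  using that multipartite unfolding complete_multipartite_def by blast

lemma X_disjoint: "X i \<inter> X j = {}" if "i \<in> {1..r}" "j \<in> {1..r}" "i \<noteq> j"
  using that multipartite unfolding complete_multipartite_def disjoint_family_on_def by blast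

lemma V_eq: "V = (\<Union>i\<in>{1..r}. X i)"
  using multipartite unfolding complete_multipartite_def by blast

lemma part_eq: "part v = i" if "i \<in> {1..r}" "v \<in> X i"
  unfolding part_def
proof (rule the_equality)
  fix j assume "j \<in> {1..r} \<and> v \<in> X j"
  then show "j = i"
    using that X_disjoint by blast
qed (use that in simp)

lemma part_in: "part v \<in> {1..r}" "v \<in> X (part v)" if v: "v \<in> V"
proof -
  obtain i where "i \<in> {1..r}" "v \<in> X i"
    using v unfolding V_eq by blast
  then show "part v \<in> {1..r}" "v \<in> X (part v)"
    using part_eq by auto
qed

lemma X_eq: "X i = {v \<in> V. part v = i}" if "i \<in> {1..r}"
proof -
  have "X i \<subseteq> V"
    using that unfolding V_eq by blast
  then show ?thesis
    using that part_eq part_in(2) by auto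
qed

lemma arc_iff: "(u, v) \<in> parcs G \<longleftrightarrow> part u \<noteq> part v" if "u \<in> V" "v \<in> V"
proof -
  have "(u, v) \<in> parcs G \<longleftrightarrow> (\<exists>i\<in>{1..r}. \<exists>j\<in>{1..r}. i \<noteq> j \<and> u \<in> X i \<and> v \<in> X j)"
    using that multipartite by (simp add: complete_multipartite_def)
  also have "\<dots> \<longleftrightarrow> part u \<noteq> part v"
    using part_eq part_in that by metis
  finally show ?thesis .
qed

text \<open>This is where \<open>two_parts\<close> enters: it supplies a midpoint for every pair
  inside one part.\<close>

lemma ex_in_other_part:
  obtains z where "z \<in> V" "part z \<noteq> i"
proof -
  obtain j where j: "j \<in> {1..r}" "j \<noteq> i"
    using two_parts by (cases "i = 1") (auto intro: that[of 1] that[of 2])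
  then obtain z where "z \<in> X j"
    using X_nonempty[OF j(1)] by blast
  then show thesis
    using that[of z] j X_eq by auto
qed

lemma two_le_card_V: "2 \<le> card V"
proof -
  \<comment> \<open>No part has index 0, so this merely picks some vertex.\<close>
  obtain z where "z \<in> V" "part z \<noteq> 0"
    by (rule ex_in_other_part)
  moreover obtain w where "w \<in> V" "part w \<noteq> part z"
    by (rule ex_in_other_part)
  ultimately have "card {z, w} = 2" "{z, w} \<subseteq> V"
    by (auto simp: card_2_iff)
  then show ?thesis
    using card_mono[OF finite_V] by metis
qed

section \<open>Shortest paths\<close>

lemma shortest_path_edge:
  assumes "x \<in> V" "y \<in> V" "part x \<noteq> part y"
  shows "shortest_path G x [x, y] y"
  unfolding shortest_path_def
proof safe
  have "x \<noteq> y" using assms by auto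
  then show "path_between G x [x, y] y"
    using assms by (auto simp: path_between_def vpath_def vwalk_def arc_iff)
  fix q assume "path_between G x q y"
  with \<open>x \<noteq> y\<close> show "vwalk_length [x, y] \<le> vwalk_length q"
    by (auto elim!: path_between_Cons_Cons)
qed

text \<open>No edge joins two vertices of one part, so a path between them has at least two edges;
  \<open>z\<close> is adjacent to both ends and attains this.\<close>

lemma shortest_path_midpoint:
  assumes "x \<in> V" "y \<in> V" "z \<in> V" "x \<noteq> y" "part x = part y" "part z \<noteq> part x"
  shows "shortest_path G x [x, z, y] y"
  unfolding shortest_path_def
proof safe
  show "path_between G x [x, z, y] y"
    using assms by (auto simp: path_between_def vpath_def vwalk_def arc_iff)
  fix q assume "path_between G x q y"
  then obtain w q' where q: "q = x # w # q'" "last (w # q') = y" "(x, w) \<in> parcs G"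
    using assms by (auto elim: path_between_Cons_Cons)
  have "q' \<noteq> []"
    using q assms arc_iff[of x y] by auto
  then show "vwalk_length [x, z, y] \<le> vwalk_length q"
    using q by (cases q') auto
qed

text \<open>Comparison with the explicit paths above leaves \<open>p\<close> two or three vertices.
  Only its vertex set is recorded, since coverage depends on nothing else.\<close>

lemma set_shortest_path_cases:
  assumes "shortest_path G x p y" "x \<noteq> y"
  obtains (edge) "part x \<noteq> part y" "set p = {x, y}"
  | (midpoint) z where "part x = part y" "part z \<noteq> part x" "set p = {x, z, y}"
proof -
  \<comment> \<open>\<open>vwalk_length\<close> is the number of vertices minus one, truncated at 0;
    as neither list is empty, the comparison passes to \<open>length\<close>.\<close>
  have short: "length p \<le> length q" if "path_between G x q y" for q
  proof -
    have "length p - 1 \<le> length q - 1" "p \<noteq> []" "q \<noteq> []"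
      using assms that by (auto simp: shortest_path_def path_between_def vpath_def vwalk_def)
    then show ?thesis
      by (cases p; cases q) auto
  qed
  obtain z q where p: "p = x # z # q" "last (z # q) = y" "distinct p" "set p \<subseteq> V"
    "(x, z) \<in> parcs G"
    using assms by (auto simp: shortest_path_def elim: path_between_Cons_Cons)
  have xy: "x \<in> V" "y \<in> V" "z \<in> V"
    using p last_in_set[of "z # q"] by auto
  show thesis
  proof (cases "part x = part y")
    case False
    then have "length p \<le> 2"
      using short[of "[x, y]"] shortest_path_edge xy by (auto simp: shortest_path_def)
    then show thesis
      using p False by (auto intro: edge)
  next
    case True
    obtain w where "w \<in> V" "part w \<noteq> part x"
      by (rule ex_in_other_part)
    then have "length p \<le> 3"
      using short[of "[x, w, y]"] shortest_path_midpoint[of x y w] xy True assms(2)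
      by (auto simp: shortest_path_def)
    moreover have "part z \<noteq> part x"
      using p xy arc_iff by auto
    ultimately have "set p = {x, z, y}"
      using p True by (cases q) auto
    then show thesis
      using True \<open>part z \<noteq> part x\<close> by (intro midpoint)
  qed
qed

section \<open>Monochromatic pairs and the Hall-type criterion\<close>

lemma finite_mono_pairs: "finite (mono_pairs S)" if "S \<subseteq> V"
  by (rule finite_subset[of _ "Pow V"]) (use that finite_V in \<open>auto simp: mono_pairs_def\<close>)

text \<open>Membership in \<open>mono_pairs\<close> makes the image of \<open>e\<close> under
  \<open>part\<close> a singleton, so \<open>the_elem\<close> returns a genuine colour.\<close>

lemma mono_pairs_of_colour:
  assumes "S \<subseteq> V" "i \<in> {1..r}"
  shows "{e \<in> mono_pairs S. the_elem (part ` e) = i} = {e. e \<subseteq> S \<inter> X i \<and> card e = 2}"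
proof (intro set_eqI iffI)
  fix e assume e: "e \<in> {e. e \<subseteq> S \<inter> X i \<and> card e = 2}"
  then have "e \<noteq> {}" by auto
  with e have "part ` e = {i}"
    using assms X_eq by auto
  with e show "e \<in> {e \<in> mono_pairs S. the_elem (part ` e) = i}"
    by (auto simp: mono_pairs_def)
next
  fix e assume "e \<in> {e \<in> mono_pairs S. the_elem (part ` e) = i}"
  then obtain j where e: "e \<subseteq> S" "card e = 2" "part ` e = {j}" and "the_elem (part ` e) = i"
    unfolding mono_pairs_def by blast
  then have "j = i"
    by simp
  have "part v = i" if "v \<in> e" for v
    using imageI[OF that, of part] e(3) \<open>j = i\<close> by simp
  then show "e \<in> {e. e \<subseteq> S \<inter> X i \<and> card e = 2}"
    using e assms X_eq by auto
qed

lemma card_mono_pairs_of_colour: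
  assumes "S \<subseteq> V" "i \<in> {1..r}"
  shows "card {e \<in> mono_pairs S. the_elem (part ` e) = i} = card (S \<inter> X i) choose 2"
  unfolding mono_pairs_of_colour[OF assms]
  by (rule n_subsets) (meson assms(1) finite_Int finite_V finite_subset)

lemma card_mono_pairs: "card (mono_pairs S) = num_pairs S" if S: "S \<subseteq> V"
proof -
  have "mono_pairs S = (\<Union>i\<in>{1..r}. {e \<in> mono_pairs S. the_elem (part ` e) = i})"
  proof -
    have "the_elem (part ` e) \<in> {1..r}" if e: "e \<in> mono_pairs S" for e
    proof -
      obtain i where "part ` e = {i}" "e \<subseteq> V"
        using e S by (auto simp: mono_pairs_def)
      then obtain v where "v \<in> V" "part v = i"
        by (metis imageE insertI1 subsetD)
      then show ?thesis
        using part_in[of v] \<open>part ` e = {i}\<close> by simp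
    qed
    then show ?thesis by auto
  qed
  also have "card \<dots> = num_pairs S"
    unfolding num_pairs_def using finite_mono_pairs[OF S]
    by (subst card_UN_disjoint) (auto simp: card_mono_pairs_of_colour[OF S])
  finally show ?thesis .
qed

text \<open>A selected path has at most one vertex outside \<open>S\<close>, its midpoint. Choosing
  for each vertex outside \<open>S\<close> a pair whose path covers it gives \<open>h\<close>;
  conversely \<open>h\<close> prescribes midpoints. The bound on \<open>card S\<close> provides a
  pair at every vertex of \<open>S\<close>, which is then covered as an endpoint.\<close>

lemma strong_geodetic_set_iff_injection:
  "strong_geodetic_set G S \<longleftrightarrow> S \<subseteq> V \<and> 2 \<le> card S \<and>
     (\<exists>h. inj_on h (V - S) \<and> h ` (V - S) \<subseteq> mono_pairs S \<and>
        (\<forall>v\<in>V - S. the_elem (part ` h v) \<noteq> part v))"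
  (is "?L \<longleftrightarrow> ?R")
proof
  assume ?L
  moreover have "card V \<noteq> 1"
    using two_le_card_V by simp
  ultimately have S: "S \<subseteq> V" and "\<exists>g :: 'a set \<Rightarrow> 'a vwalk.
      (\<forall>e. e \<subseteq> S \<and> card e = 2 \<longrightarrow> (\<exists>x y. e = {x, y} \<and> shortest_path G x (g e) y)) \<and>
      (\<Union>e\<in>{e. e \<subseteq> S \<and> card e = 2}. set (g e)) = V"
    by (simp_all only: strong_geodetic_set_def if_False simp_thms)
  then obtain g :: "'a set \<Rightarrow> 'a vwalk" where
    paths: "\<forall>e. e \<subseteq> S \<and> card e = 2 \<longrightarrow> (\<exists>x y. e = {x, y} \<and> shortest_path G x (g e) y)"
    and cover: "(\<Union>e\<in>{e. e \<subseteq> S \<and> card e = 2}. set (g e)) = V"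
    by (elim exE conjE)
  have g: "\<exists>x y. e = {x, y} \<and> shortest_path G x (g e) y" if "e \<subseteq> S" "card e = 2" for e
    using paths that by blast
  have "\<exists>e. e \<subseteq> S \<and> card e = 2 \<and> v \<in> set (g e)" if "v \<in> V" for v
    using that cover by blast
  then obtain h where h: "\<And>v. v \<in> V \<Longrightarrow> h v \<subseteq> S \<and> card (h v) = 2 \<and> v \<in> set (g (h v))"
    by metis
  \<comment> \<open>The ends of the path lie in \<open>S\<close> and \<open>v\<close> does not, so
    \<open>v\<close> is the midpoint. It is the only vertex of the path outside \<open>S\<close>,
    hence determined by \<open>h v\<close>.\<close>
  have key: "(\<exists>i. part ` h v = {i} \<and> i \<noteq> part v) \<and> set (g (h v)) - S = {v}"
    if v: "v \<in> V - S" for v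
  proof -
    have hv: "h v \<subseteq> S" "card (h v) = 2" "v \<in> set (g (h v))"
      using h v by auto
    then obtain x y where e: "h v = {x, y}" and path: "shortest_path G x (g (h v)) y"
      using g by blast
    have "x \<noteq> y"
      using hv e by auto
    with path show ?thesis
      by (cases rule: set_shortest_path_cases) (use hv e v in auto)
  qed
  have "inj_on h (V - S)"
    using key by (metis inj_onI singleton_inject)
  moreover have "h ` (V - S) \<subseteq> mono_pairs S"
  proof (rule image_subsetI)
    fix v assume "v \<in> V - S"
    then show "h v \<in> mono_pairs S"
      using h[of v] key[of v] unfolding mono_pairs_def by blast
  qed
  moreover have "the_elem (part ` h v) \<noteq> part v" if "v \<in> V - S" for v
    using key[OF that] by auto
  moreover have "2 \<le> card S"
  proof -
    obtain v where "v \<in> V"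
      using two_le_card_V by fastforce
    then show ?thesis
      using h[of v] card_mono[of S "h v"] S finite_V finite_subset by metis
  qed
  ultimately show ?R
    using S by blast
next
  assume ?R
  then obtain h where S: "S \<subseteq> V" "2 \<le> card S"
    and h: "inj_on h (V - S)" "h ` (V - S) \<subseteq> mono_pairs S"
      "\<And>v. v \<in> V - S \<Longrightarrow> the_elem (part ` h v) \<noteq> part v"
    by auto
  have "\<exists>p. (\<exists>x y. e = {x, y} \<and> shortest_path G x p y) \<and> (\<forall>v\<in>V - S. h v = e \<longrightarrow> v \<in> set p)"
    if e: "e \<subseteq> S" "card e = 2" for e
  proof -
    obtain x y where xy: "e = {x, y}" "x \<noteq> y"
      using e(2) by (auto simp: card_2_iff)
    then have xyV: "x \<in> V" "y \<in> V"
      using e S by auto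
    show ?thesis
    proof (cases "part x = part y")
      case False
      have "h v \<noteq> e" if "v \<in> V - S" for v
      proof
        assume "h v = e"
        then have "e \<in> mono_pairs S"
          using h(2) that by blast
        then show False
          using xy False by (auto simp: mono_pairs_def)
      qed
      then show ?thesis
        using shortest_path_edge[OF xyV False] xy by blast
    next
      case True
      \<comment> \<open>By injectivity \<open>e\<close> serves at most one vertex; a pair that
        serves none takes an arbitrary midpoint.\<close>
      have "\<exists>z\<in>V. part z \<noteq> part x \<and> (\<forall>v\<in>V - S. h v = e \<longrightarrow> v = z)"
      proof (cases "e \<in> h ` (V - S)")
        case True
        then obtain z where z: "z \<in> V - S" "h z = e" by blast
        have "part ` e = {part x}"
          using xy \<open>part x = part y\<close> by auto
        then have "part z \<noteq> part x"
          using h(3)[OF z(1)] z(2) by simp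
        moreover have "v = z" if "v \<in> V - S" "h v = e" for v
          using inj_onD[OF h(1), of v z] z that by simp
        ultimately show ?thesis
          using z by blast
      next
        case False
        then show ?thesis
          using ex_in_other_part[of "part x"] by blast
      qed
      then obtain z where z: "z \<in> V" "part z \<noteq> part x" "\<forall>v\<in>V - S. h v = e \<longrightarrow> v = z"
        by blast
      have "shortest_path G x [x, z, y] y"
        using shortest_path_midpoint xyV z xy True by blast
      then show ?thesis
        using xy z(3) by (intro exI[of _ "[x, z, y]"]) auto
    qed
  qed
  then obtain g where g: "\<And>e. e \<subseteq> S \<Longrightarrow> card e = 2 \<Longrightarrow>
      (\<exists>x y. e = {x, y} \<and> shortest_path G x (g e) y) \<and> (\<forall>v\<in>V - S. h v = e \<longrightarrow> v \<in> set (g e))"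
    by metis
  have ends: "e \<subseteq> set (g e)" if e: "e \<subseteq> S" "card e = 2" for e
  proof -
    obtain x y where xy: "e = {x, y}" "shortest_path G x (g e) y"
      using g[OF e] by blast
    then have "x \<noteq> y"
      using e(2) by auto
    with xy(2) show ?thesis
      by (cases rule: set_shortest_path_cases) (use xy in auto)
  qed
  have "(\<Union>e\<in>{e. e \<subseteq> S \<and> card e = 2}. set (g e)) = V"
  proof (intro equalityI subsetI)
    fix v assume "v \<in> (\<Union>e\<in>{e. e \<subseteq> S \<and> card e = 2}. set (g e))"
    then obtain e where "e \<subseteq> S" "card e = 2" "v \<in> set (g e)" by blast
    then show "v \<in> V"
      using g[of e] by (auto simp: shortest_path_def path_between_def vpath_def vwalk_def)
  next
    fix v assume v: "v \<in> V"
    show "v \<in> (\<Union>e\<in>{e. e \<subseteq> S \<and> card e = 2}. set (g e))"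
    proof (cases "v \<in> S")
      case True
      have "S \<noteq> {v}"
        using S(2) by auto
      then obtain w where "w \<in> S" "w \<noteq> v"
        using True by blast
      then have "{v, w} \<subseteq> S" "card {v, w} = 2"
        using True by auto
      then show ?thesis
        using ends[of "{v, w}"] by blast
    next
      case False
      then have "h v \<subseteq> S" "card (h v) = 2"
        using h(2) v by (auto simp: mono_pairs_def)
      then show ?thesis
        using g[of "h v"] v False by blast
    qed
  qed
  then show ?L
    using S(1) g two_le_card_V by (auto simp: strong_geodetic_set_def intro!: exI[of _ g])
qed

text \<open>Necessity is a count: \<open>h\<close> is injective and sends \<open>X i - S\<close> to
  pairs not of colour \<open>i\<close>. Sufficiency is \<open>ex_inj_on_off_colour\<close>, with
  vertices coloured by \<open>part\<close> and pairs by the part that contains them.\<close>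

lemma strong_geodetic_set_iff:
  "strong_geodetic_set G S \<longleftrightarrow> S \<subseteq> V \<and> 2 \<le> card S \<and> card (V - S) \<le> num_pairs S \<and>
     (\<forall>i\<in>{1..r}. card (X i - S) + (card (S \<inter> X i) choose 2) \<le> num_pairs S)"
  (is "_ \<longleftrightarrow> ?R")
proof
  assume "strong_geodetic_set G S"
  then obtain h where S: "S \<subseteq> V" "2 \<le> card S"
    and h: "inj_on h (V - S)" "h ` (V - S) \<subseteq> mono_pairs S"
      "\<And>v. v \<in> V - S \<Longrightarrow> the_elem (part ` h v) \<noteq> part v"
    by (auto simp: strong_geodetic_set_iff_injection)
  note fin = finite_mono_pairs[OF S(1)]
  have "card (V - S) \<le> num_pairs S"
    using card_inj_on_le[OF h(1,2) fin] card_mono_pairs[OF S(1)] by simp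
  moreover have "card (X i - S) + (card (S \<inter> X i) choose 2) \<le> num_pairs S" if i: "i \<in> {1..r}" for i
  proof -
    have sub: "X i - S \<subseteq> V - S"
      using X_eq[OF i] by auto
    have "card (X i - S) = card (h ` (X i - S))"
      using inj_on_subset[OF h(1) sub] by (simp add: card_image)
    also have "\<dots> + card {e \<in> mono_pairs S. the_elem (part ` e) = i} =
        card (h ` (X i - S) \<union> {e \<in> mono_pairs S. the_elem (part ` e) = i})"
    proof (rule card_Un_disjoint[symmetric])
      show "finite (h ` (X i - S))"
        using sub finite_V by (meson finite_Diff finite_imageI finite_subset)
      show "h ` (X i - S) \<inter> {e \<in> mono_pairs S. the_elem (part ` e) = i} = {}"
      proof (rule equals0I)
        fix e assume "e \<in> h ` (X i - S) \<inter> {e \<in> mono_pairs S. the_elem (part ` e) = i}"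
        then obtain v where "v \<in> X i - S" "the_elem (part ` h v) = i"
          by blast
        then show False
          using h(3)[of v] X_eq[OF i] by simp
      qed
    qed (use fin in simp)
    also have "\<dots> \<le> card (mono_pairs S)"
      using h(2) sub by (intro card_mono fin) auto
    finally show ?thesis
      using S(1) i by (simp add: card_mono_pairs card_mono_pairs_of_colour)
  qed
  ultimately show ?R
    using S by blast
next
  assume R: ?R
  then have S: "S \<subseteq> V" by blast
  have "\<exists>h. inj_on h (V - S) \<and> h ` (V - S) \<subseteq> mono_pairs S \<and>
      (\<forall>v\<in>V - S. the_elem (part ` h v) \<noteq> part v)"
  proof (rule ex_inj_on_off_colour)
    fix i assume "i \<in> part ` (V - S)"
    then have i: "i \<in> {1..r}"
      using part_in by auto
    have "{v \<in> V - S. part v = i} = X i - S"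
      using X_eq[OF i] by auto
    then show "card {v \<in> V - S. part v = i} + card {e \<in> mono_pairs S. the_elem (part ` e) = i}
        \<le> card (mono_pairs S)"
      using R i S by (simp add: card_mono_pairs card_mono_pairs_of_colour)
  qed (use R S finite_V finite_mono_pairs card_mono_pairs in auto)
  then show "strong_geodetic_set G S"
    using R by (simp add: strong_geodetic_set_iff_injection)
qed

section \<open>Existence of optimal sets and the exchange argument\<close>

lemma strong_geodetic_set_V: "strong_geodetic_set G V"
proof -
  have "card (X i - V) + (card (V \<inter> X i) choose 2) \<le> num_pairs V" if i: "i \<in> {1..r}" for i
  proof -
    have "X i - V = {}"
      using X_eq[OF i] by auto
    moreover have "(card (V \<inter> X i) choose 2) \<le> num_pairs V"
      unfolding num_pairs_def by (rule member_le_sum) (use i in auto)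
    ultimately show ?thesis
      by (simp only: card.empty add_0)
  qed
  then show ?thesis
    unfolding strong_geodetic_set_iff using two_le_card_V by simp
qed

text \<open>Trading \<open>x\<close> for \<open>y\<close> keeps the size and raises
  \<open>num_pairs\<close> by \<open>card (S \<inter> X b) - card (S \<inter> X c) + 1\<close>, at
  least 1 by \<open>le\<close>. The hypothesis \<open>slack\<close> is the condition for part
  \<open>b\<close> after the exchange; all others survive.\<close>

lemma strong_geodetic_set_move:
  assumes S: "strong_geodetic_set G S"
    and bc: "b \<in> {1..r}" "c \<in> {1..r}" "b \<noteq> c"
    and x: "x \<in> S \<inter> X c" and y: "y \<in> X b - S"
    and le: "card (S \<inter> X c) \<le> card (S \<inter> X b)"
    and slack: "card (X b - S) + (card (S \<inter> X b) choose 2) + card (S \<inter> X c) \<le> num_pairs S + 2"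
  shows "\<exists>T. strong_geodetic_set G T \<and> card T = card S \<and> num_pairs S < num_pairs T"
proof -
  define T where "T = insert y (S - {x})"
  have SV: "S \<subseteq> V" and S2: "2 \<le> card S" and total: "card (V - S) \<le> num_pairs S"
    and each: "\<And>i. i \<in> {1..r} \<Longrightarrow> card (X i - S) + (card (S \<inter> X i) choose 2) \<le> num_pairs S"
    using S by (auto simp: strong_geodetic_set_iff)
  have fin: "finite S" "\<And>i. i \<in> {1..r} \<Longrightarrow> finite (X i)"
    using SV finite_V X_eq by (auto intro: finite_subset)
  have TV: "T \<subseteq> V"
    using SV y X_eq[OF bc(1)] by (auto simp: T_def)
  have card_T: "card T = card S"
    using x y fin card_Suc_Diff1[of S x] by (simp add: T_def)
  have xb: "x \<notin> X b" and yc: "y \<notin> X c"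
    using x y X_disjoint[OF bc] by auto
  have other: "T \<inter> X i = S \<inter> X i" "X i - T = X i - S" if "i \<in> {1..r}" "i \<noteq> b" "i \<noteq> c" for i
    using x y X_disjoint[OF that(1) bc(1) that(2)] X_disjoint[OF that(1) bc(2) that(3)]
    by (auto simp: T_def)
  obtain t where t: "card (S \<inter> X c) = Suc t"
    using x fin(1) by (cases "card (S \<inter> X c)") auto
  have "T \<inter> X c = S \<inter> X c - {x}"
    using yc by (auto simp: T_def)
  then have Tc: "card (T \<inter> X c) = t"
    using t x by simp
  have "X c - T = insert x (X c - S)"
    using yc x y by (auto simp: T_def)
  then have Tc': "card (X c - T) = Suc (card (X c - S))"
    using x fin(2)[OF bc(2)] by simp
  have "T \<inter> X b = insert y (S \<inter> X b)"
    using xb y by (auto simp: T_def)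
  then have Tb: "card (T \<inter> X b) = Suc (card (S \<inter> X b))"
    using y fin by simp
  have "X b - T = X b - S - {y}"
    using xb by (auto simp: T_def)
  then have Tb': "Suc (card (X b - T)) = card (X b - S)"
    using y fin(2)[OF bc(1)] card_Suc_Diff1[of "X b - S" y] by simp
  have num: "num_pairs U = (card (U \<inter> X b) choose 2) + (card (U \<inter> X c) choose 2) +
      (\<Sum>i\<in>{1..r} - {b, c}. card (U \<inter> X i) choose 2)" for U
    unfolding num_pairs_def using bc
    by (subst sum.subset_diff[of "{b, c}"]) auto
  have "(\<Sum>i\<in>{1..r} - {b, c}. card (T \<inter> X i) choose 2) =
      (\<Sum>i\<in>{1..r} - {b, c}. card (S \<inter> X i) choose 2)"
    by (rule sum.cong) (auto simp: other)
  \<comment> \<open>Part \<open>b\<close> gains one pair for each vertex it already had in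
    \<open>S\<close>, and part \<open>c\<close> loses \<open>t\<close> pairs. The additive form
    avoids subtraction of naturals.\<close>
  then have gain: "num_pairs T + t = num_pairs S + card (S \<inter> X b)"
    unfolding num[of T] num[of S] using t Tc Tb by (simp add: choose_two_Suc)
  have "strong_geodetic_set G T"
    unfolding strong_geodetic_set_iff
  proof (intro conjI ballI)
    have "card (V - T) = card (V - S)"
      using TV SV card_T fin(1) by (simp add: T_def card_Diff_subset)
    then show "card (V - T) \<le> num_pairs T"
      using total gain le t by simp
    fix i assume i: "i \<in> {1..r}"
    consider "i = b" | "i = c" | "i \<noteq> b" "i \<noteq> c" by blast
    then show "card (X i - T) + (card (T \<inter> X i) choose 2) \<le> num_pairs T"
    proof cases
      \<comment> \<open>This is \<open>slack\<close> rearranged. Its 2 collects one unit from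
        \<open>y\<close> entering the set and one from \<open>t\<close> being one less than
        \<open>card (S \<inter> X c)\<close>.\<close>
      case 1
      then show ?thesis
        using slack gain Tb Tb' t by (simp add: choose_two_Suc)
    next
      \<comment> \<open>Part \<open>c\<close> has one more vertex to cover and \<open>t\<close>
        fewer pairs of its own, while \<open>num_pairs\<close> grew by at least 1.\<close>
      case 2
      then show ?thesis
        using each[OF bc(2)] gain le Tc Tc' t by (simp add: choose_two_Suc)
    next
      case 3
      then show ?thesis
        using each[OF i] gain le t other[OF i] by simp
    qed
  qed (use TV S2 card_T in auto)
  then show ?thesis
    using card_T gain le t by (intro exI[of _ T]) simp
qed

lemma ex_more_pairs:
  assumes S: "strong_geodetic_set G S"
    and abc: "{a, b, c} \<subseteq> {1..r}" "a \<noteq> b" "a \<noteq> c" "b \<noteq> c"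
    and split: "\<not> X a \<subseteq> S" "\<not> X b \<subseteq> S" "\<not> X c \<subseteq> S" "S \<inter> X c \<noteq> {}"
    and le: "card (S \<inter> X c) \<le> card (S \<inter> X a)" "card (S \<inter> X c) \<le> card (S \<inter> X b)"
  shows "\<exists>T. strong_geodetic_set G T \<and> card T = card S \<and> num_pairs S < num_pairs T"
proof -
  have SV: "S \<subseteq> V" and total: "card (V - S) \<le> num_pairs S"
    using S by (auto simp: strong_geodetic_set_iff)
  have fin: "finite (X i)" if "i \<in> {1..r}" for i
    using that finite_V X_eq by simp
  have disj: "X i \<inter> X j = {}" if "i \<in> {a, b, c}" "j \<in> {a, b, c}" "i \<noteq> j" for i j
    using that abc(1) X_disjoint by blast
  have "card (X a - S) + card (X b - S) + card (X c - S) =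
      card (\<Union>i\<in>{a, b, c}. X i - S)"
    using abc fin disj by (subst card_UN_disjoint) auto
  also have "\<dots> \<le> card (V - S)"
    using finite_V abc(1) X_eq by (intro card_mono) auto
  finally have u: "card (X a - S) + card (X b - S) + card (X c - S) \<le> num_pairs S"
    using total by simp
  have uc: "0 < card (X c - S)"
    using split fin abc by (auto simp: card_gt_0_iff)
  have "(\<Sum>i\<in>{a, b, c}. card (S \<inter> X i) choose 2) \<le> num_pairs S"
    unfolding num_pairs_def using abc by (intro sum_mono2) auto
  then have p: "(card (S \<inter> X a) choose 2) + (card (S \<inter> X b) choose 2) +
      (card (S \<inter> X c) choose 2) \<le> num_pairs S"
    using abc by simp
  \<comment> \<open>With \<open>M = num_pairs S\<close>, two failures would add up to at least
    \<open>2 * M + 6\<close>, but \<open>u\<close>, \<open>uc\<close>, \<open>p\<close> and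
    \<open>double_le_choose_two\<close> bound the sum of the two left sides by
    \<open>2 * M + 2\<close>.\<close>
  have "card (X a - S) + (card (S \<inter> X a) choose 2) + card (S \<inter> X c) \<le> num_pairs S + 2 \<or>
      card (X b - S) + (card (S \<inter> X b) choose 2) + card (S \<inter> X c) \<le> num_pairs S + 2"
    using u uc p double_le_choose_two[of "card (S \<inter> X c)"] by linarith
  then obtain d where d: "d \<in> {a, b}"
    "card (X d - S) + (card (S \<inter> X d) choose 2) + card (S \<inter> X c) \<le> num_pairs S + 2"
    by blast
  obtain x where "x \<in> S \<inter> X c"
    using split by blast
  moreover obtain y where "y \<in> X d - S"
    using split d by blast
  ultimately show ?thesis
    using d abc le by (intro strong_geodetic_set_move[OF S, of d c x y]) auto
qed

lemma ex_optimal_at_most_two_split: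
  "\<exists>S. optimal_strong_geodetic_set G S \<and>
     card {i \<in> {1..r}. \<not> (S \<inter> X i = {} \<or> S \<inter> X i = X i)} \<le> 2"
proof -
  define Q where "Q S \<longleftrightarrow> optimal_strong_geodetic_set G S" for S
  have "\<exists>S. Q S"
    unfolding Q_def optimal_strong_geodetic_set_def sg_def
    \<comment> \<open>The minimum in \<open>sg\<close> is attained because \<open>V\<close> itself
      is a strong geodetic set.\<close>
    by (rule LeastI_ex) (use strong_geodetic_set_V in blast)
  moreover have "finite {S. Q S}"
    by (rule finite_subset[of _ "Pow V"])
      (use finite_V in \<open>auto simp: Q_def optimal_strong_geodetic_set_def strong_geodetic_set_def\<close>)
  ultimately obtain S where S: "Q S" and best: "\<And>T. Q T \<Longrightarrow> num_pairs T \<le> num_pairs S"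
    using finite_has_maximal[of "num_pairs ` {S. Q S}"] by (auto simp: image_iff) (metis linear)
  define B where "B = {i \<in> {1..r}. \<not> (S \<inter> X i = {} \<or> S \<inter> X i = X i)}"
  have "card B \<le> 2"
  proof (rule ccontr)
    assume "\<not> card B \<le> 2"
    then have card_B: "3 \<le> card B" by simp
    then have "B \<noteq> {}"
      by auto
    \<comment> \<open>A split part with fewest vertices in \<open>S\<close> may give one of them to
      either of two other split parts.\<close>
    then obtain c where c: "c \<in> B" "\<And>i. i \<in> B \<Longrightarrow> card (S \<inter> X c) \<le> card (S \<inter> X i)"
      using ex_has_least_nat[of "\<lambda>i. i \<in> B" _ "\<lambda>i. card (S \<inter> X i)"] by blast
    have "2 \<le> card (B - {c})"
      using card_B c(1) by simp
    then obtain A where "A \<subseteq> B - {c}" "card A = 2"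
      by (meson obtain_subset_with_card_n)
    then obtain a b where ab: "a \<in> B" "b \<in> B" "a \<noteq> b" "a \<noteq> c" "b \<noteq> c"
      by (auto simp: card_2_iff)
    have in_B: "i \<in> {1..r} \<and> \<not> X i \<subseteq> S \<and> S \<inter> X i \<noteq> {}" if "i \<in> B" for i
      using that by (auto simp: B_def)
    have "strong_geodetic_set G S"
      using S by (simp add: Q_def optimal_strong_geodetic_set_def)
    then have "\<exists>T. strong_geodetic_set G T \<and> card T = card S \<and> num_pairs S < num_pairs T"
      by (rule ex_more_pairs[of S a b c])
        (use in_B[OF ab(1)] in_B[OF ab(2)] in_B[OF c(1)] in \<open>simp_all add: ab c\<close>)
    then obtain T where T: "strong_geodetic_set G T" "card T = card S" "num_pairs S < num_pairs T"
      by blast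
    then have "Q T"
      using S by (simp add: Q_def optimal_strong_geodetic_set_def)
    then show False
      using best[of T] T(3) by simp
  qed
  with S show ?thesis
    unfolding Q_def B_def by (intro exI conjI)
qed

end

section \<open>Fewer than two parts, and the theorem\<close>

lemma connected_one_part:
  assumes multi: "complete_multipartite G r X"
    and conn: "Digraph_Component.connected (with_proj G)"
    and "r < 2"
  shows "card (pverts G) = 1"
proof -
  have "parcs G = {}"
  proof (rule ccontr)
    assume "parcs G \<noteq> {}"
    then obtain u v where uv: "(u, v) \<in> parcs G" by auto
    then have "u \<in> pverts G" "v \<in> pverts G"
      using multi pair_wf_digraph.arc_fst_in_verts[of G "(u, v)"]
        pair_wf_digraph.arc_snd_in_verts[of G "(u, v)"]
      by (auto simp: complete_multipartite_def pair_graph_def pair_digraph_def pair_fin_digraph_def)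
    with uv multi have "\<exists>i\<in>{1..r}. \<exists>j\<in>{1..r}. i \<noteq> j"
      unfolding complete_multipartite_def by blast
    with \<open>r < 2\<close> show False by auto
  qed
  \<comment> \<open>\<open>connected\<close> means strong connectedness of the symmetric closure, so
    the absence of arcs is carried over to it; reachability then reduces to equality.\<close>
  then have no_arcs: "parcs (mk_symmetric (with_proj G)) = {}"
    by (simp add: mk_symmetric_def)
  have verts: "pverts (mk_symmetric (with_proj G)) = pverts G"
    by (simp add: mk_symmetric_def)
  have strong: "pverts G \<noteq> {}"
    "\<And>u v. u \<in> pverts G \<Longrightarrow> v \<in> pverts G \<Longrightarrow> u \<rightarrow>\<^sup>*\<^bsub>with_proj (mk_symmetric (with_proj G))\<^esub> v"
    using conn by (auto simp: connected_def strongly_connected_def verts)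
  have "u = v" if "u \<in> pverts G" "v \<in> pverts G" for u v
    using reachable_rtranclI[OF strong(2)[OF that]] no_arcs by simp
  with strong(1) show ?thesis
    by (metis card_1_singleton_iff equals0I is_singletonI' is_singleton_def One_nat_def)
qed

theorem proposition1p1:
  fixes G :: "'a pair_pre_digraph" and r :: nat and X :: "nat \<Rightarrow> 'a set"
  assumes "complete_multipartite G r X"
    and "Digraph_Component.connected (with_proj G)"
  shows "\<exists>S. optimal_strong_geodetic_set G S \<and>
           card {i \<in> {1..r}. \<not> (S \<inter> X i = {} \<or> S \<inter> X i = X i)} \<le> 2"
proof (cases "2 \<le> r")
  case True
  then interpret multipartite G r X
    using assms(1) by unfold_locales
  show ?thesis
    by (rule ex_optimal_at_most_two_split)
next
  case False
  then have "card (pverts G) = 1"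
    by (intro connected_one_part[OF assms]) simp
  \<comment> \<open>For a single vertex the definition of strong geodetic sets takes its special
    branch.\<close>
  then have iff: "strong_geodetic_set G S \<longleftrightarrow> S = pverts G" for S
    by (auto simp: strong_geodetic_set_def)
  have "optimal_strong_geodetic_set G (pverts G)"
    unfolding optimal_strong_geodetic_set_def sg_def iff
    by (auto intro!: Least_equality[symmetric])
  moreover have "card {i \<in> {1..r}. \<not> (pverts G \<inter> X i = {} \<or> pverts G \<inter> X i = X i)} \<le> card {1..r}"
    by (intro card_mono) auto
  ultimately show ?thesis
    using False by (intro exI[of _ "pverts G"]) simp
qed

end
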